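(* For any distinct prime numbers $p_1,p_2,p_3$ and natural numbers $n_1,n_2,n_3\ge 1$, $$Cl_2(\mathbb{Z}_{p_1^{n_1}p_2^{n_2}p_3^{n_3}})\cong\begin{cases}Shu^4_{(p_2^{n_2}-p_2^{n_2-1})(p_3^{n_3}-p_3^{n_3-1})}(G_1), & \text{if } p_1^{n_1}=2,\\ Shu^8_{2(p_2^{n_2}-p_2^{n_2-1})(p_3^{n_3}-p_3^{n_3-1})}(G_1), & \text{if } p_1^{n_1}=4,\\ Shu^{16}_{m}(G_1), & \text{if } p_1=2,\ n_1\geq 3,\\ Shu^8_{m}(G_1), & \text{if } p_1,p_2,p_3\neq 2,\end{cases}$$ where $m=(p_1^{n_1}-p_1^{n_1-1})(p_2^{n_2}-p_2^{n_2-1})(p_3^{n_3}-p_3^{n_3-1})$ and $G_1$ is the simple graph with vertex set $\{a,b,c,d,e,f\}$ and edge set $\{ab,\,bc,\,ac,\,ad,\,be,\,cf\}$.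
   Context: $\mathbb{Z}_N$ is the ring of integers modulo $N$. For a ring $R$ with identity, $Id(R)$ is the set of idempotents and $U(R)$ the set of units. $Cl_2(R)$ is the simple undirected graph with vertex set $\{(e,u): e\in Id(R)\setminus\{0\},\ u\in U(R)\}$, in which two distinct vertices $(e,u)$ and $(f,v)$ are adjacent if and only if $ef=fe=0$ or $uv=vu=1$. The $(t,n)$-shuriken graph: let $G$ be a simple graph and let $n,t$ be positive integers with $n-t$ even ($t\le n$ in all uses here). Add a new vertex $z\notin V(G)$ to $G$ and take $n$ copies of the resulting graph; $G'_i$ is the $i$-th copy, with vertex set $V(G'_i)=\{z_i\}\cup\{v_i: v\in V(G)\}$. Then $Shu^t_n(G)$ is the simple graph with vertex set $\bigcup_{i=1}^n V(G'_i)$ and edge set $$\{u_iv_j: uv\in E(G),\ i,j\in\{1,\dots,n\}\}\cup\{u_iv_i: u_i,v_i\in V(G'_i),\ u_i\ne v_i,\ i\in\{1,\dots,t\}\}\cup\left\{u_iv_{n+t+1-i}: u_i\in V(G'_i),\ v_{n+t+1-i}\in V(G'_{n+t+1-i}),\ i\in\{t+1,\dots,\tfrac{n+t}{2}\}\right\},$$ where in the last two sets $u$ and $v$ range over $V(G)\cup\{z\}$ (with $u=v$ allowed in the last set). *)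

theory Defs
  imports "Graph_Theory.Graph_Theory" "HOL-Number_Theory.Residues"
begin

text \<open>
  A simple undirected graph is represented as a \<^typ>\<open>'a pair_pre_digraph\<close> whose arc relation is
  symmetric and irreflexive: the undirected edge \<open>xy\<close> is the pair of arcs \<open>(x, y)\<close>, \<open>(y, x)\<close>.
  \<^const>\<open>mk_symmetric\<close> turns a set of edges, each listed in one orientation, into such a graph.
\<close>

definition idempotents :: "('a, 'b) ring_scheme \<Rightarrow> 'a set" where
  "idempotents R = {e \<in> carrier R. e \<otimes>\<^bsub>R\<^esub> e = e}"

definition clean_graph2 :: "('a, 'b) ring_scheme \<Rightarrow> ('a \<times> 'a) pair_pre_digraph" where
  "clean_graph2 R =
     (let V = (idempotents R - {\<zero>\<^bsub>R\<^esub>}) \<times> Units R in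
      \<lparr> pverts = V,
        parcs = {((e, u), (f, v)) | e u f v.
                   (e, u) \<in> V \<and> (f, v) \<in> V \<and> (e, u) \<noteq> (f, v) \<and>
                   ((e \<otimes>\<^bsub>R\<^esub> f = \<zero>\<^bsub>R\<^esub> \<and> f \<otimes>\<^bsub>R\<^esub> e = \<zero>\<^bsub>R\<^esub>) \<or>
                    (u \<otimes>\<^bsub>R\<^esub> v = \<one>\<^bsub>R\<^esub> \<and> v \<otimes>\<^bsub>R\<^esub> u = \<one>\<^bsub>R\<^esub>))} \<rparr>)"

text \<open>
  \<open>shuriken t n G\<close> is \<open>Shu\<^sup>t\<^sub>n(G)\<close>.  The vertex \<open>(Some v, i)\<close> is the copy \<open>v\<^sub>i\<close> of a vertex \<open>v\<close>
  of \<open>G\<close>, and \<open>(None, i)\<close> is \<open>z\<^sub>i\<close>.  The definition is meant for \<open>1 \<le> t \<le> n\<close> with \<open>n - t\<close> even;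
  then \<open>(n + t) div 2\<close> is exact, the subtraction \<open>n + t + 1 - i\<close> does not truncate, and
  \<open>i \<mapsto> n + t + 1 - i\<close> matches the copies \<open>t + 1, \<dots>, n\<close> in pairs.
\<close>

definition shuriken :: "nat \<Rightarrow> nat \<Rightarrow> 'a pair_pre_digraph \<Rightarrow> ('a option \<times> nat) pair_pre_digraph"
  where
  "shuriken t n G =
     (let V' = insert None (Some ` pverts G) in
      mk_symmetric (with_proj
        \<lparr> pverts = V' \<times> {1..n},
          parcs =
            {((Some u, i), (Some v, j)) | u v i j.
               (u, v) \<in> parcs G \<and> i \<in> {1..n} \<and> j \<in> {1..n}} \<union>
            {((x, i), (y, i)) | x y i.
               x \<in> V' \<and> y \<in> V' \<and> x \<noteq> y \<and> i \<in> {1..t}} \<union>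
            {((x, i), (y, n + t + 1 - i)) | x y i.
               x \<in> V' \<and> y \<in> V' \<and> i \<in> {t + 1..(n + t) div 2}} \<rparr>))"

datatype G1_vertex = va | vb | vc | vd | ve | vf

definition G1 :: "G1_vertex pair_pre_digraph" where
  "G1 = mk_symmetric (with_proj
     \<lparr> pverts = {va, vb, vc, vd, ve, vf},
       parcs = {(va, vb), (vb, vc), (va, vc), (va, vd), (vb, ve), (vc, vf)} \<rparr>)"

end

theory Submission
  imports Defs "HOL-Number_Theory.Prime_Powers"
begin

text \<open>
  A vertex of the clean graph is a pair \<open>(e, u)\<close>, and its two kinds of edges live in the two
  coordinates separately: \<open>ef = 0\<close> says nothing about the units, and \<open>uv = 1\<close> says nothing about
  the idempotents.  The shuriken graph has the same shape.  Its vertices are pairs \<open>(x, i)\<close> with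
  \<open>x\<close> in \<open>G\<close> extended by a point \<open>z\<close> and \<open>i\<close> the number of a copy; one kind of edge is an edge
  of \<open>G\<close> in the first coordinate, the other joins the copy \<open>i\<close> completely to a partner copy,
  where the partner map is an involution of \<open>{1..n}\<close> with fixed points \<open>1, \<dots>, t\<close>
  (\<open>parcs_shuriken\<close>).

  Inversion is an involution of the group of units, and two involutions of finite sets are
  conjugate as soon as they have the same numbers of points and of fixed points
  (\<open>involution_enumeration\<close>).  So for every ring with finitely many units the clean graph is the
  shuriken graph of the orthogonality graph of its nonzero idempotents, where \<open>n\<close> is the number of
  units and \<open>t\<close> the number of units that square to 1, provided that one idempotent is isolated in
  this orthogonality graph and takes the role of \<open>z\<close> (\<open>clean_graph2_iso_shuriken\<close>); the identity
  is such an idempotent.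

  For \<open>\<int>\<^sub>N\<close> with \<open>N = q\<^sub>1q\<^sub>2q\<^sub>3\<close> a product of three coprime prime powers, an idempotent is
  congruent to 0 or 1 modulo each \<open>q\<^sub>i\<close>.  By the Chinese remainder theorem the nonzero idempotents
  correspond to the nonempty sets of indices \<open>i\<close> at which they are congruent to 1, and two of them
  are orthogonal iff their sets are disjoint.  The disjointness graph of the nonempty subsets of a
  three-element set is \<open>G\<^sub>1\<close> (the singletons form the triangle, each joined to its complement)
  together with the whole set as an isolated point
  (\<open>clean_graph2_residue_ring3_iso_shuriken\<close>).

  The number of units is Euler's totient of \<open>N\<close>.  The number of square roots of 1 is multiplicative,
  again by the Chinese remainder theorem (\<open>card_sqrts_of_1_mult\<close>); it is 2 modulo a power of an odd
  prime, and 1, 2, 4 modulo 2, 4 and the higher powers of 2.  This gives the values 4, 8, 16, 8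
  of \<open>t\<close> in the four cases.
\<close>

section \<open>Adjacency in shuriken graphs\<close>

text \<open>
  The reflection \<open>i \<mapsto> n + t + 1 - i\<close> maps \<open>{t + 1..n}\<close> to itself; when \<open>n - t\<close> is even it has no
  fixed point there.
\<close>

definition partner :: "nat \<Rightarrow> nat \<Rightarrow> nat \<Rightarrow> nat" where
  "partner t n i = (if i \<le> t then i else n + t + 1 - i)"

lemma parcs_mk_symmetric_with_proj:
  "parcs (mk_symmetric (with_proj G)) = parcs G \<union> (parcs G)\<inverse>"
  by (force simp: parcs_mk_symmetric)

text \<open>
  The complete join inside each of the first \<open>t\<close> copies and the joins between matched later copies
  are the same rule \<open>j = partner t n i\<close>.  For odd \<open>n - t\<close> the rule would in addition join the middle
  copy, of index \<open>(n + t + 1) div 2\<close>, to itself.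
\<close>

lemma parcs_shuriken:
  assumes G: "pair_sym_digraph G" and tn: "t \<le> n" "even (n - t)"
  shows "((x, i), (y, j)) \<in> parcs (shuriken t n G) \<longleftrightarrow>
    x \<in> insert None (Some ` pverts G) \<and> y \<in> insert None (Some ` pverts G) \<and>
    i \<in> {1..n} \<and> j \<in> {1..n} \<and>
    ((\<exists>u v. x = Some u \<and> y = Some v \<and> (u, v) \<in> parcs G) \<or>
     (j = partner t n i \<and> (x, i) \<noteq> (y, j)))"
  (is "?arc \<longleftrightarrow> ?x \<and> ?y \<and> ?i \<and> ?j \<and> (?e \<or> ?p)")
proof -
  interpret pair_sym_digraph G by fact
  define V where "V = insert None (Some ` pverts G)"
  define A where "A = {((Some u, i), (Some v, j)) | u v i j.
      (u, v) \<in> parcs G \<and> i \<in> {1..n} \<and> j \<in> {1..n}}"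
  define B where "B = {((x, i), (y, i)) | x y i. x \<in> V \<and> y \<in> V \<and> x \<noteq> y \<and> i \<in> {1..t}}"
  define C where "C = {((x, i), (y, n + t + 1 - i)) | x y i.
      x \<in> V \<and> y \<in> V \<and> i \<in> {t + 1..(n + t) div 2}}"
  obtain k where n: "n = t + 2 * k"
    using tn by (metis dvdE le_add_diff_inverse)
  have "parcs (shuriken t n G) = (A \<union> B \<union> C) \<union> (A \<union> B \<union> C)\<inverse>"
    unfolding shuriken_def Let_def parcs_mk_symmetric_with_proj V_def[symmetric]
      A_def B_def C_def by simp
  then have arc: "?arc \<longleftrightarrow> ((x, i), (y, j)) \<in> A \<union> A\<inverse> \<or> ((x, i), (y, j)) \<in> B \<union> B\<inverse>
      \<or> ((x, i), (y, j)) \<in> C \<union> C\<inverse>"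
    by blast
  have a: "((x, i), (y, j)) \<in> A \<union> A\<inverse> \<longleftrightarrow> ?e \<and> ?i \<and> ?j"
  proof -
    have "((x, i), (y, j)) \<in> A \<union> A\<inverse> \<longleftrightarrow>
        (\<exists>u v. x = Some u \<and> y = Some v \<and> ((u, v) \<in> parcs G \<or> (v, u) \<in> parcs G)) \<and> ?i \<and> ?j"
      unfolding A_def by auto
    then show ?thesis using arcs_symmetric by blast
  qed
  have b: "((x, i), (y, j)) \<in> B \<union> B\<inverse> \<longleftrightarrow> x \<in> V \<and> y \<in> V \<and> i = j \<and> x \<noteq> y \<and> i \<in> {1..t}"
    by (auto simp: B_def)
  have c: "((x, i), (y, j)) \<in> C \<union> C\<inverse> \<longleftrightarrow>
      x \<in> V \<and> y \<in> V \<and> i \<in> {t + 1..n} \<and> j = n + t + 1 - i"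
  proof -
    have "((x, i), (y, j)) \<in> C \<union> C\<inverse> \<longleftrightarrow> x \<in> V \<and> y \<in> V \<and>
        (i \<in> {t + 1..t + k} \<and> j = n + t + 1 - i \<or> j \<in> {t + 1..t + k} \<and> i = n + t + 1 - j)"
      unfolding C_def n by auto
    also have "(i \<in> {t + 1..t + k} \<and> j = n + t + 1 - i \<or> j \<in> {t + 1..t + k} \<and> i = n + t + 1 - j)
        \<longleftrightarrow> i \<in> {t + 1..n} \<and> j = n + t + 1 - i"
      unfolding n by (cases "i \<le> t + k") auto
    finally show ?thesis .
  qed
  have e: "?e \<Longrightarrow> x \<in> V \<and> y \<in> V"
    by (auto simp: V_def dest: in_arcsD1 in_arcsD2)
  have no_fixpoint: "i \<noteq> n + t + 1 - i" if "i \<in> {t + 1..n}"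
  proof
    assume "i = n + t + 1 - i"
    then have "2 * i = 2 * (t + k) + 1"
      using that n by simp
    then have "even (2 * (t + k) + 1)" by (metis dvd_triv_left)
    then show False by simp
  qed
  show ?thesis
  proof (cases "i \<le> t")
    case True
    then show ?thesis
      unfolding arc a b c V_def[symmetric] partner_def using e tn by auto
  next
    case False
    then show ?thesis
      unfolding arc a b c V_def[symmetric] partner_def using e no_fixpoint by auto
  qed
qed

lemma pverts_shuriken: "pverts (shuriken t n G) = insert None (Some ` pverts G) \<times> {1..n}"
  by (simp add: shuriken_def Let_def)

section \<open>From clean graphs to shuriken graphs\<close>

text \<open>
  An involution splits its domain into its fixed points and two halves \<open>A\<close> and \<open>B\<close> that it swaps.
  Number the fixed points by \<open>1, \<dots>, t\<close> and \<open>A\<close> by the next \<open>k\<close> numbers in any way; the numbering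
  of \<open>B\<close> is then forced.
\<close>

lemma involution_enumeration:
  fixes f :: "'a \<Rightarrow> 'a"
  assumes fin: "finite U" and maps: "\<And>u. u \<in> U \<Longrightarrow> f u \<in> U"
    and inv: "\<And>u. u \<in> U \<Longrightarrow> f (f u) = u"
  defines "t \<equiv> card {u \<in> U. f u = u}" and "n \<equiv> card U"
  shows "\<exists>\<sigma>. bij_betw \<sigma> U {1..n} \<and> (\<forall>u\<in>U. \<sigma> (f u) = partner t n (\<sigma> u))"
    and "t \<le> n" and "even (n - t)"
proof -
  \<comment> \<open>An auxiliary ranking picks one element of each two-element orbit.\<close>
  obtain r :: "'a \<Rightarrow> nat" where r: "inj_on r U"
    using finite_imp_inj_to_nat_seg[OF fin] by blast
  define F where "F = {u \<in> U. f u = u}"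
  define A where "A = {u \<in> U. r u < r (f u)}"
  define B where "B = {u \<in> U. r (f u) < r u}"
  define k where "k = card A"
  have U: "U = F \<union> A \<union> B"
    using r maps by (auto simp: F_def A_def B_def inj_on_def)
  have disj: "F \<inter> A = {}" "F \<inter> B = {}" "A \<inter> B = {}"
    by (auto simp: F_def A_def B_def)
  have fin': "finite F" "finite A" "finite B"
    using fin by (auto simp: F_def A_def B_def)
  have fBA: "bij_betw f B A"
    by (rule bij_betw_byWitness[where f' = f]) (auto simp: A_def B_def maps inv)
  have fAB: "f u \<in> B" if "u \<in> A" for u
    using that by (auto simp: A_def B_def maps inv)
  have n: "n = t + 2 * k"
    unfolding n_def t_def F_def[symmetric] k_def
    unfolding U using fin' disj bij_betw_same_card[OF fBA]
    by (simp add: card_Un_disjoint Int_Un_distrib2)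
  then show "t \<le> n" "even (n - t)" by simp_all
  have "\<exists>g. bij_betw g F {1..t}"
    using fin' by (intro finite_same_card_bij) (simp_all add: t_def F_def)
  then obtain g where g: "bij_betw g F {1..t}" ..
  have "\<exists>h. bij_betw h A {1..k}"
    using fin' by (intro finite_same_card_bij) (simp_all add: k_def)
  then obtain h0 where h0: "bij_betw h0 A {1..k}" ..
  define h where "h u = h0 u + t" for u
  have h: "bij_betw h A {t + 1..t + k}"
  proof -
    have "bij_betw (\<lambda>i. i + t) {1..k} {t + 1..t + k}"
      by (rule bij_betw_byWitness[where f' = "\<lambda>i. i - t"]) auto
    from bij_betw_trans[OF h0 this] show ?thesis by (simp add: h_def[abs_def] comp_def)
  qed
  have h': "bij_betw (\<lambda>u. n + t + 1 - h (f u)) B {t + k + 1..n}"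
  proof -
    have "bij_betw (\<lambda>i. n + t + 1 - i) {t + 1..t + k} {t + k + 1..n}"
      by (rule bij_betw_byWitness[where f' = "\<lambda>i. n + t + 1 - i"]) (auto simp: n)
    from bij_betw_trans[OF bij_betw_trans[OF fBA h] this] show ?thesis by (simp add: comp_def)
  qed
  define \<sigma> where
    "\<sigma> u = (if u \<in> F then g u else if u \<in> A then h u else n + t + 1 - h (f u))" for u
  have F\<sigma>: "bij_betw \<sigma> F {1..t}"
    using g by (rule iffD1[OF bij_betw_cong, rotated]) (simp add: \<sigma>_def)
  have A\<sigma>: "bij_betw \<sigma> A {t + 1..t + k}"
    using h by (rule iffD1[OF bij_betw_cong, rotated]) (use disj in \<open>auto simp: \<sigma>_def\<close>)
  have B\<sigma>: "bij_betw \<sigma> B {t + k + 1..n}"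
    using h' by (rule iffD1[OF bij_betw_cong, rotated]) (use disj in \<open>auto simp: \<sigma>_def\<close>)
  have "bij_betw \<sigma> U ({1..t} \<union> {t + 1..t + k} \<union> {t + k + 1..n})"
    unfolding U by (intro bij_betw_combine F\<sigma> A\<sigma> B\<sigma>) auto
  also have "{1..t} \<union> {t + 1..t + k} \<union> {t + k + 1..n} = {1..n}"
    using n by auto
  finally have bij: "bij_betw \<sigma> U {1..n}" .
  have "\<sigma> (f u) = partner t n (\<sigma> u)" if u: "u \<in> U" for u
  proof -
    consider "u \<in> F" | "u \<in> A" | "u \<in> B" using u U by blast
    then show ?thesis
    proof cases
      case 1
      then have "f u = u" "\<sigma> u \<in> {1..t}"
        using F\<sigma> by (auto simp: F_def bij_betw_def)
      then show ?thesis by (simp add: partner_def)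
    next
      case 2
      then have "\<sigma> u \<in> {t + 1..t + k}" using A\<sigma> by (auto simp: bij_betw_def)
      moreover have "\<sigma> (f u) = n + t + 1 - \<sigma> u"
        using 2 fAB[OF 2] disj inv[OF u] by (auto simp: \<sigma>_def)
      ultimately show ?thesis by (simp add: partner_def)
    next
      case 3
      then have fu: "f u \<in> A" using fBA by (auto simp: bij_betw_def)
      then have "h (f u) \<in> {t + 1..t + k}" using h by (auto simp: bij_betw_def)
      moreover have "\<sigma> (f u) = h (f u)" "\<sigma> u = n + t + 1 - h (f u)"
        using 3 fu disj by (auto simp: \<sigma>_def)
      ultimately show ?thesis using n by (auto simp: partner_def)
    qed
  qed
  with bij show "\<exists>\<sigma>. bij_betw \<sigma> U {1..n} \<and> (\<forall>u\<in>U. \<sigma> (f u) = partner t n (\<sigma> u))"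
    by blast
qed

lemma digraph_iso_with_projI:
  assumes G: "pair_wf_digraph G" and H: "pair_wf_digraph H"
    and h: "bij_betw h (pverts G) (pverts H)"
    and arcs: "\<And>x y. x \<in> pverts G \<Longrightarrow> y \<in> pverts G \<Longrightarrow>
      (x, y) \<in> parcs G \<longleftrightarrow> (h x, h y) \<in> parcs H"
  shows "digraph_iso (with_proj G) (with_proj H)"
proof -
  interpret G: pair_wf_digraph G by fact
  interpret H: pair_wf_digraph H by fact
  define hom where "hom = \<lparr> iso_verts = h, iso_arcs = map_prod h h, iso_head = snd, iso_tail = fst \<rparr>"
  have inj: "inj_on h (pverts G)" and im: "h ` pverts G = pverts H"
    using h by (auto simp: bij_betw_def)
  have sub: "parcs G \<subseteq> pverts G \<times> pverts G"
    by (auto dest: G.in_arcsD1 G.in_arcsD2)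
  have "inj_on (map_prod h h) (parcs G)"
    using map_prod_inj_on[OF inj inj] sub by (rule inj_on_subset)
  then have "pre_digraph.digraph_isomorphism (with_proj G) hom"
    unfolding pre_digraph.digraph_isomorphism_def
    using inj by (simp add: hom_def G.wf_digraph_axioms)
  moreover have "map_prod h h ` parcs G = parcs H"
  proof (intro equalityI subsetI)
    fix a assume "a \<in> map_prod h h ` parcs G"
    then obtain x y where xy: "(x, y) \<in> parcs G" "a = (h x, h y)"
      by auto
    then show "a \<in> parcs H"
      using arcs[of x y] by (blast dest: G.in_arcsD1 G.in_arcsD2)
  next
    fix a assume a: "a \<in> parcs H"
    obtain x' y' where a': "a = (x', y')" by (cases a)
    then have "x' \<in> pverts H" "y' \<in> pverts H"
      using a by (auto dest: H.in_arcsD1 H.in_arcsD2)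
    then obtain x y where "x \<in> pverts G" "y \<in> pverts G" "x' = h x" "y' = h y"
      unfolding im[symmetric] by blast
    then show "a \<in> map_prod h h ` parcs G"
      using arcs a a' by force
  qed
  then have "with_proj H = app_iso hom (with_proj G)"
    by (simp add: app_iso_def hom_def im with_proj_def)
  ultimately show ?thesis unfolding digraph_iso_def by blast
qed

text \<open>
  The isomorphism is the product of the labelling \<open>\<psi>\<close> of idempotents with an enumeration of the
  units that carries inversion to the partner map.  No edge of the first kind is lost to the
  requirement \<open>(e, u) \<noteq> (f, v)\<close>: an idempotent with \<open>ee = 0\<close> is zero, so \<open>ef = 0\<close> forces
  \<open>e \<noteq> f\<close>.
\<close>

lemma clean_graph2_iso_shuriken:
  assumes R: "ring R" and fin: "finite (Units R)" and G: "pair_sym_digraph G"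
    and \<psi>: "bij_betw \<psi> (idempotents R - {\<zero>\<^bsub>R\<^esub>}) (insert None (Some ` pverts G))"
    and orth: "\<And>e f. e \<in> idempotents R - {\<zero>\<^bsub>R\<^esub>} \<Longrightarrow> f \<in> idempotents R - {\<zero>\<^bsub>R\<^esub>} \<Longrightarrow>
      e \<otimes>\<^bsub>R\<^esub> f = \<zero>\<^bsub>R\<^esub> \<and> f \<otimes>\<^bsub>R\<^esub> e = \<zero>\<^bsub>R\<^esub> \<longleftrightarrow>
      (\<exists>u v. \<psi> e = Some u \<and> \<psi> f = Some v \<and> (u, v) \<in> parcs G)"
  shows "digraph_iso (with_proj (clean_graph2 R))
    (with_proj (shuriken (card {u \<in> Units R. u \<otimes>\<^bsub>R\<^esub> u = \<one>\<^bsub>R\<^esub>}) (card (Units R)) G))"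
proof -
  interpret R: ring R by fact
  define E where "E = idempotents R - {\<zero>\<^bsub>R\<^esub>}"
  define V where "V = insert None (Some ` pverts G)"
  define n where "n = card (Units R)"
  define t where "t = card {u \<in> Units R. inv\<^bsub>R\<^esub> u = u}"
  have inv_iff: "u \<otimes>\<^bsub>R\<^esub> v = \<one>\<^bsub>R\<^esub> \<and> v \<otimes>\<^bsub>R\<^esub> u = \<one>\<^bsub>R\<^esub> \<longleftrightarrow> v = inv\<^bsub>R\<^esub> u"
    if "u \<in> Units R" "v \<in> Units R" for u v
    using that by (metis R.Units_closed R.Units_l_inv R.Units_r_inv R.inv_char)
  have "inv\<^bsub>R\<^esub> u = u \<longleftrightarrow> u \<otimes>\<^bsub>R\<^esub> u = \<one>\<^bsub>R\<^esub>" if "u \<in> Units R" for u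
    using inv_iff[OF that that] by auto
  then have t: "card {u \<in> Units R. u \<otimes>\<^bsub>R\<^esub> u = \<one>\<^bsub>R\<^esub>} = t"
    unfolding t_def by (metis (no_types, lifting))
  note enum = involution_enumeration[of "Units R" "m_inv R", OF fin R.Units_inv_Units R.Units_inv_inv,
      folded n_def t_def]
  obtain \<sigma> where \<sigma>: "bij_betw \<sigma> (Units R) {1..n}"
    and \<sigma>_inv: "\<And>u. u \<in> Units R \<Longrightarrow> \<sigma> (inv\<^bsub>R\<^esub> u) = partner t n (\<sigma> u)"
    using enum(1) by auto
  note arc = parcs_shuriken[OF G enum(2,3), folded V_def]
  define h where "h = map_prod \<psi> \<sigma>"
  have verts: "pverts (clean_graph2 R) = E \<times> Units R"
    by (simp add: clean_graph2_def Let_def E_def)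
  have bij: "bij_betw h (pverts (clean_graph2 R)) (pverts (shuriken t n G))"
    unfolding verts pverts_shuriken V_def[symmetric] h_def
    using \<psi> \<sigma> unfolding E_def V_def by (rule bij_betw_map_prod)
  have "digraph_iso (with_proj (clean_graph2 R)) (with_proj (shuriken t n G))"
  proof (rule digraph_iso_with_projI[OF _ _ bij])
    show "pair_wf_digraph (clean_graph2 R)"
      by unfold_locales (auto simp: clean_graph2_def Let_def)
    show "pair_wf_digraph (shuriken t n G)"
      by unfold_locales (auto simp: pverts_shuriken arc V_def[symmetric])
  next
    fix x y
    assume "x \<in> pverts (clean_graph2 R)" "y \<in> pverts (clean_graph2 R)"
    then obtain e u f v where xy: "x = (e, u)" "y = (f, v)"
      and ef: "e \<in> E" "f \<in> E" and uv: "u \<in> Units R" "v \<in> Units R"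
      by (auto simp: verts)
    have ne: "(e, u) \<noteq> (f, v) \<longleftrightarrow> (\<psi> e, \<sigma> u) \<noteq> (\<psi> f, \<sigma> v)"
      using ef uv \<psi> \<sigma> by (auto simp: bij_betw_def inj_on_def E_def)
    have "e \<noteq> f" if "e \<otimes>\<^bsub>R\<^esub> f = \<zero>\<^bsub>R\<^esub>"
      using that ef by (auto simp: E_def idempotents_def)
    then have "(x, y) \<in> parcs (clean_graph2 R) \<longleftrightarrow>
        (e \<otimes>\<^bsub>R\<^esub> f = \<zero>\<^bsub>R\<^esub> \<and> f \<otimes>\<^bsub>R\<^esub> e = \<zero>\<^bsub>R\<^esub>) \<or>
        (u \<otimes>\<^bsub>R\<^esub> v = \<one>\<^bsub>R\<^esub> \<and> v \<otimes>\<^bsub>R\<^esub> u = \<one>\<^bsub>R\<^esub>) \<and> (e, u) \<noteq> (f, v)"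
      using ef uv unfolding xy by (auto simp: clean_graph2_def Let_def E_def[symmetric])
    also have "\<dots> \<longleftrightarrow> (\<exists>a b. \<psi> e = Some a \<and> \<psi> f = Some b \<and> (a, b) \<in> parcs G) \<or>
        \<sigma> v = partner t n (\<sigma> u) \<and> (\<psi> e, \<sigma> u) \<noteq> (\<psi> f, \<sigma> v)"
    proof -
      have "v = inv\<^bsub>R\<^esub> u \<longleftrightarrow> \<sigma> v = \<sigma> (inv\<^bsub>R\<^esub> u)"
        using \<sigma> uv by (auto simp: bij_betw_def inj_on_def)
      then show ?thesis
        using orth[folded E_def, OF ef] inv_iff[OF uv] \<sigma>_inv[OF uv(1)] ne by simp
    qed
    also have "\<dots> \<longleftrightarrow> (h x, h y) \<in> parcs (shuriken t n G)"
    proof -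
      have "\<psi> e \<in> V" "\<psi> f \<in> V" "\<sigma> u \<in> {1..n}" "\<sigma> v \<in> {1..n}"
        using ef uv \<psi> \<sigma> by (auto simp: bij_betw_def E_def V_def)
      then show ?thesis by (simp add: xy h_def arc)
    qed
    finally show "(x, y) \<in> parcs (clean_graph2 R) \<longleftrightarrow> (h x, h y) \<in> parcs (shuriken t n G)" .
  qed
  then show ?thesis by (simp add: t n_def)
qed

section \<open>Idempotents modulo a product of three prime powers\<close>

text \<open>
  This is how both equations of the proof are solved modulo \<open>p ^ k\<close>: \<open>x\<^sup>2 = x\<close> is
  \<open>p ^ k dvd x (x - 1)\<close> and \<open>x\<^sup>2 = 1\<close> is \<open>p ^ k dvd (x - 1) (x + 1)\<close>, where \<open>p\<close> does not divide both
  factors, the latter for odd \<open>p\<close>.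
\<close>

lemma prime_power_dvd_mult_cases:
  fixes p a b :: int
  assumes "prime p" and "p ^ k dvd a * b" and "\<not> (p dvd a \<and> p dvd b)"
  shows "p ^ k dvd a \<or> p ^ k dvd b"
proof -
  have "coprime (p ^ k) a \<or> coprime (p ^ k) b"
    using assms by (auto intro: prime_imp_coprime)
  with assms(2) show ?thesis
    by (auto simp: coprime_dvd_mult_left_iff coprime_dvd_mult_right_iff)
qed

lemma primepow_int_gt_1: "primepow q \<Longrightarrow> q > (1 :: int)"
  by (auto simp: primepow_def intro: one_less_power dest: prime_gt_1_int)

lemma idempotent_mod_primepow:
  fixes q x :: int
  assumes "primepow q" and "[x * x = x] (mod q)"
  shows "[x = 0] (mod q) \<or> [x = 1] (mod q)"
proof -
  obtain p k where p: "prime p" and q: "q = p ^ k"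
    using assms(1) by (auto simp: primepow_def)
  have "p ^ k dvd x * (x - 1)"
    using assms(2) by (simp add: q cong_iff_dvd_diff algebra_simps)
  moreover have "\<not> (p dvd x \<and> p dvd x - 1)"
    using p by (metis dvd_diff_right_iff not_prime_unit)
  ultimately show ?thesis
    using prime_power_dvd_mult_cases[OF p] by (simp add: q cong_iff_dvd_diff)
qed

text \<open>
  An idempotent \<open>x\<close> that is not divisible by \<open>q\<close> is congruent to 1, hence can be cancelled.
\<close>

lemma primepow_dvd_idempotent_mult_iff:
  fixes q x y :: int
  assumes "primepow q" and "[x * x = x] (mod q)"
  shows "q dvd x * y \<longleftrightarrow> q dvd x \<or> q dvd y"
proof -
  have "[x * y = y] (mod q)" if "\<not> q dvd x"
    using idempotent_mod_primepow[OF assms] that cong_scalar_right[of x 1 q y]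
    by (auto simp: cong_0_iff)
  then show ?thesis
    using cong_dvd_iff by auto
qed

lemma primepow_dvd_eq_imp_idempotents_cong:
  fixes q x y :: int
  assumes "primepow q" and "[x * x = x] (mod q)" and "[y * y = y] (mod q)"
    and "q dvd x \<longleftrightarrow> q dvd y"
  shows "[x = y] (mod q)"
  using idempotent_mod_primepow[OF assms(1,2)] idempotent_mod_primepow[OF assms(1,3)] assms(4)
  by (metis cong_0_iff cong_sym cong_trans)

lemma cong_mult3_iff:
  fixes q1 q2 q3 x y :: int
  assumes "coprime q1 q2" and "coprime q1 q3" and "coprime q2 q3"
  shows "[x = y] (mod q1 * q2 * q3) \<longleftrightarrow>
    [x = y] (mod q1) \<and> [x = y] (mod q2) \<and> [x = y] (mod q3)"
proof
  assume "[x = y] (mod q1) \<and> [x = y] (mod q2) \<and> [x = y] (mod q3)"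
  then show "[x = y] (mod q1 * q2 * q3)"
    using assms by (simp add: coprime_cong_mult)
qed (auto intro: cong_dvd_modulus)

lemma chinese_remainder3:
  fixes q1 q2 q3 :: int
  assumes "coprime q1 q2" and "coprime q1 q3" and "coprime q2 q3"
  shows "\<exists>x. [x = a1] (mod q1) \<and> [x = a2] (mod q2) \<and> [x = a3] (mod q3)"
proof -
  obtain y where y: "[y = a1] (mod q1)" "[y = a2] (mod q2)"
    using binary_chinese_remainder_int[OF assms(1)] by blast
  have "coprime (q1 * q2) q3" using assms by simp
  then obtain x where x: "[x = y] (mod q1 * q2)" "[x = a3] (mod q3)"
    using binary_chinese_remainder_int by blast
  have "[x = y] (mod q1)" "[x = y] (mod q2)"
    using x(1) by (auto intro: cong_dvd_modulus)
  with x(2) y show ?thesis by (blast intro: cong_trans)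
qed

text \<open>
  The support of \<open>e\<close> is recorded as the indicator of the set of factors that do not divide it; for
  an idempotent these are the factors modulo which it is 1.
\<close>

definition support :: "int \<Rightarrow> int \<Rightarrow> int \<Rightarrow> int \<Rightarrow> bool \<times> bool \<times> bool" where
  "support q1 q2 q3 e = (\<not> q1 dvd e, \<not> q2 dvd e, \<not> q3 dvd e)"

context
  fixes q1 q2 q3 :: int
  assumes primepow: "primepow q1" "primepow q2" "primepow q3"
    and coprime: "coprime q1 q2" "coprime q1 q3" "coprime q2 q3"
begin

private abbreviation "N \<equiv> q1 * q2 * q3"

private lemma pos: "N > 0"
  using primepow[THEN primepow_int_gt_1] by simp

lemma idempotents_residue_ring3:
  "e \<in> idempotents (residue_ring N) \<longleftrightarrow> e \<in> {0..<N} \<and>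
    [e * e = e] (mod q1) \<and> [e * e = e] (mod q2) \<and> [e * e = e] (mod q3)"
proof -
  have "e \<in> idempotents (residue_ring N) \<longleftrightarrow> e \<in> {0..<N} \<and> [e * e = e] (mod N)"
    by (auto simp: idempotents_def residue_ring_def cong_def)
  then show ?thesis by (simp only: cong_mult3_iff[OF coprime])
qed

lemma idempotents_orthogonal_iff:
  assumes "e \<in> idempotents (residue_ring N)"
  shows "e \<otimes>\<^bsub>residue_ring N\<^esub> f = \<zero>\<^bsub>residue_ring N\<^esub> \<longleftrightarrow>
    (q1 dvd e \<or> q1 dvd f) \<and> (q2 dvd e \<or> q2 dvd f) \<and> (q3 dvd e \<or> q3 dvd f)"
proof -
  have "e \<otimes>\<^bsub>residue_ring N\<^esub> f = \<zero>\<^bsub>residue_ring N\<^esub> \<longleftrightarrow> [e * f = 0] (mod N)"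
    by (simp add: residue_ring_def cong_def)
  also have "\<dots> \<longleftrightarrow> q1 dvd e * f \<and> q2 dvd e * f \<and> q3 dvd e * f"
    by (simp only: cong_mult3_iff[OF coprime] cong_0_iff)
  finally show ?thesis
    using assms primepow by (simp add: idempotents_residue_ring3 primepow_dvd_idempotent_mult_iff)
qed

lemma bij_betw_support:
  "bij_betw (support q1 q2 q3) (idempotents (residue_ring N) - {0}) (UNIV - {(False, False, False)})"
proof (rule bij_betw_imageI)
  have inj: "e = f"
    if e: "e \<in> idempotents (residue_ring N)" and f: "f \<in> idempotents (residue_ring N)"
      and eq: "support q1 q2 q3 e = support q1 q2 q3 f" for e f
  proof -
    have "[e = f] (mod N)"
      using e f eq primepow unfolding cong_mult3_iff[OF coprime]
      by (auto simp: idempotents_residue_ring3 support_def intro!: primepow_dvd_eq_imp_idempotents_cong)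
    then show ?thesis
      using e f by (auto simp: idempotents_residue_ring3 intro: cong_less_imp_eq_int)
  qed
  then show "inj_on (support q1 q2 q3) (idempotents (residue_ring N) - {0})"
    by (intro inj_onI) blast
  have zero: "0 \<in> idempotents (residue_ring N)" "support q1 q2 q3 0 = (False, False, False)"
    using pos by (simp_all add: idempotents_residue_ring3 support_def)
  show "support q1 q2 q3 ` (idempotents (residue_ring N) - {0}) = UNIV - {(False, False, False)}"
  proof (intro equalityI subsetI)
    fix s assume "s \<in> support q1 q2 q3 ` (idempotents (residue_ring N) - {0})"
    then show "s \<in> UNIV - {(False, False, False)}"
      using inj zero by force
  next
    fix s assume s: "s \<in> UNIV - {(False, False, False)}"
    obtain s1 s2 s3 where s_eq: "s = (s1, s2, s3)" by (cases s)
    obtain x where x: "[x = of_bool s1] (mod q1)" "[x = of_bool s2] (mod q2)" "[x = of_bool s3] (mod q3)"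
      using chinese_remainder3[OF coprime] by blast
    define e where "e = x mod N"
    have "[e = x] (mod N)" by (simp add: e_def)
    then have e: "[e = of_bool s1] (mod q1)" "[e = of_bool s2] (mod q2)" "[e = of_bool s3] (mod q3)"
      using x unfolding cong_mult3_iff[OF coprime] by (blast intro: cong_trans)+
    have idem: "[e * e = e] (mod q)" if "[e = of_bool b] (mod q)" for q b
    proof -
      have "[e * e = of_bool b * of_bool b] (mod q)" using cong_mult[OF that that] .
      also have "of_bool b * of_bool b = (of_bool b :: int)" by simp
      finally show ?thesis using that by (blast intro: cong_trans cong_sym)
    qed
    have "e \<in> {0..<N}" using pos by (simp add: e_def)
    then have E: "e \<in> idempotents (residue_ring N)"
      using e by (auto simp: idempotents_residue_ring3 intro: idem)
    have dvd: "\<not> q dvd e \<longleftrightarrow> b" if "[e = of_bool b] (mod q)" "primepow q" for q b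
      using cong_dvd_iff[OF that(1)] primepow_not_unit[OF that(2)] by (cases b) simp_all
    have "support q1 q2 q3 e = s"
      using e primepow by (simp add: support_def s_eq dvd)
    moreover have "e \<noteq> 0"
      using calculation zero(2) s by auto
    ultimately show "s \<in> support q1 q2 q3 ` (idempotents (residue_ring N) - {0})"
      using E by blast
  qed
qed

end

section \<open>The orthogonality graph of the idempotents\<close>

text \<open>
  Singleton supports go to the triangle \<open>abc\<close>, their complements to the pendant vertices \<open>def\<close>, and
  the full support, which is that of the identity, to the isolated point \<^term>\<open>None\<close>.  The empty
  support, that of 0, gets the default value \<^term>\<open>None\<close>, so the map is injective only away from it.
\<close>

fun support_label :: "bool \<times> bool \<times> bool \<Rightarrow> G1_vertex option" where
  "support_label (True, False, False) = Some va"
| "support_label (False, True, False) = Some vb"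
| "support_label (False, False, True) = Some vc"
| "support_label (False, True, True) = Some vd"
| "support_label (True, False, True) = Some ve"
| "support_label (True, True, False) = Some vf"
| "support_label _ = None"

lemma pverts_G1: "pverts G1 = UNIV"
  by (auto simp: G1_def intro: G1_vertex.exhaust)

lemma parcs_G1:
  "parcs G1 = {(va, vb), (vb, vc), (va, vc), (va, vd), (vb, ve), (vc, vf),
               (vb, va), (vc, vb), (vc, va), (vd, va), (ve, vb), (vf, vc)}"
  by (auto simp: G1_def parcs_mk_symmetric_with_proj)

lemma pair_sym_digraph_G1: "pair_sym_digraph G1"
  by unfold_locales (simp_all add: pverts_G1, simp add: G1_def symmetric_mk_symmetric)

lemma bij_betw_support_label:
  "bij_betw support_label (UNIV - {(False, False, False)}) (insert None (Some ` pverts G1))"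
proof (rule bij_betw_imageI)
  show "inj_on support_label (UNIV - {(False, False, False)})"
    by (rule inj_onI, elim support_label.elims) auto
  have "x \<in> support_label ` (UNIV - {(False, False, False)})" for x
  proof (cases x)
    case None
    then show ?thesis by (intro image_eqI[of _ _ "(True, True, True)"]) auto
  next
    case (Some v)
    then show ?thesis
      by (cases v) (force intro: support_label.simps[symmetric])+
  qed
  then show "support_label ` (UNIV - {(False, False, False)}) = insert None (Some ` pverts G1)"
    by (auto simp: pverts_G1)
qed

lemma support_label_adjacent_iff:
  assumes "(a1, a2, a3) \<noteq> (False, False, False)" and "(b1, b2, b3) \<noteq> (False, False, False)"
  shows "(\<exists>u v. support_label (a1, a2, a3) = Some u \<and> support_label (b1, b2, b3) = Some v \<and>
      (u, v) \<in> parcs G1) \<longleftrightarrow> \<not> (a1 \<and> b1) \<and> \<not> (a2 \<and> b2) \<and> \<not> (a3 \<and> b3)"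
  using assms
  by (cases a1; cases a2; cases a3; cases b1; cases b2; cases b3) (simp_all add: parcs_G1)

lemma clean_graph2_residue_ring3_iso_shuriken:
  fixes q1 q2 q3 :: int
  assumes q: "primepow q1" "primepow q2" "primepow q3"
    and coprime: "coprime q1 q2" "coprime q1 q3" "coprime q2 q3"
  defines "R \<equiv> residue_ring (q1 * q2 * q3)"
  shows "digraph_iso (with_proj (clean_graph2 R))
    (with_proj (shuriken (card {u \<in> Units R. u \<otimes>\<^bsub>R\<^esub> u = \<one>\<^bsub>R\<^esub>}) (card (Units R)) G1))"
proof -
  have N: "q1 * q2 * q3 > 1"
    using q[THEN primepow_int_gt_1] by (simp add: less_1_mult)
  interpret residues "q1 * q2 * q3" R
    using N by unfold_locales (simp_all add: R_def)
  note ctxt = q coprime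
  define \<psi> where "\<psi> = support_label \<circ> support q1 q2 q3"
  have bij: "bij_betw (support q1 q2 q3) (idempotents R - {\<zero>\<^bsub>R\<^esub>}) (UNIV - {(False, False, False)})"
    using bij_betw_support[OF ctxt] by (simp only: res_zero_eq R_def[symmetric])
  show ?thesis
  proof (rule clean_graph2_iso_shuriken[OF ring_axioms finite_Units pair_sym_digraph_G1])
    show "bij_betw \<psi> (idempotents R - {\<zero>\<^bsub>R\<^esub>}) (insert None (Some ` pverts G1))"
      unfolding \<psi>_def using bij bij_betw_support_label by (rule bij_betw_trans)
  next
    fix e f
    assume ef: "e \<in> idempotents R - {\<zero>\<^bsub>R\<^esub>}" "f \<in> idempotents R - {\<zero>\<^bsub>R\<^esub>}"
    then have ne: "support q1 q2 q3 e \<noteq> (False, False, False)"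
        "support q1 q2 q3 f \<noteq> (False, False, False)"
      using bij by (auto simp: bij_betw_def)
    have carr: "e \<in> carrier R" "f \<in> carrier R"
      using ef by (auto simp: idempotents_def)
    have "e \<otimes>\<^bsub>R\<^esub> f = \<zero>\<^bsub>R\<^esub> \<and> f \<otimes>\<^bsub>R\<^esub> e = \<zero>\<^bsub>R\<^esub> \<longleftrightarrow> e \<otimes>\<^bsub>R\<^esub> f = \<zero>\<^bsub>R\<^esub>"
      using m_comm[OF carr] by auto
    also have "\<dots> \<longleftrightarrow>
        (q1 dvd e \<or> q1 dvd f) \<and> (q2 dvd e \<or> q2 dvd f) \<and> (q3 dvd e \<or> q3 dvd f)"
      using idempotents_orthogonal_iff[OF ctxt] ef by (simp add: R_def)
    also have "\<dots> \<longleftrightarrow> (\<exists>u v. \<psi> e = Some u \<and> \<psi> f = Some v \<and> (u, v) \<in> parcs G1)"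
      using support_label_adjacent_iff[OF ne[unfolded support_def]]
      by (simp add: \<psi>_def support_def)
    finally show "e \<otimes>\<^bsub>R\<^esub> f = \<zero>\<^bsub>R\<^esub> \<and> f \<otimes>\<^bsub>R\<^esub> e = \<zero>\<^bsub>R\<^esub> \<longleftrightarrow>
        (\<exists>u v. \<psi> e = Some u \<and> \<psi> f = Some v \<and> (u, v) \<in> parcs G1)" .
  qed
qed

section \<open>Square roots of 1\<close>

definition sqrts_of_1 :: "int \<Rightarrow> int set" where
  "sqrts_of_1 m = {x \<in> {0..<m}. [x * x = 1] (mod m)}"

lemma bij_betw_chinese_remainder:
  fixes a b :: int
  assumes "coprime a b" and "a > 0" and "b > 0"
  shows "bij_betw (\<lambda>x. (x mod a, x mod b)) {0..<a * b} ({0..<a} \<times> {0..<b})"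
proof (rule bij_betw_imageI)
  show "inj_on (\<lambda>x. (x mod a, x mod b)) {0..<a * b}"
  proof (rule inj_onI)
    fix x y
    assume xy: "x \<in> {0..<a * b}" "y \<in> {0..<a * b}" "(x mod a, x mod b) = (y mod a, y mod b)"
    then have "[x = y] (mod a * b)"
      using assms(1) by (auto simp: cong_def[symmetric] intro: coprime_cong_mult)
    then show "x = y"
      using xy by (auto intro: cong_less_imp_eq_int)
  qed
  show "(\<lambda>x. (x mod a, x mod b)) ` {0..<a * b} = {0..<a} \<times> {0..<b}"
  proof (intro equalityI subsetI)
    fix z assume "z \<in> {0..<a} \<times> {0..<b}"
    then obtain u v where z: "z = (u, v)" "u \<in> {0..<a}" "v \<in> {0..<b}" by blast
    obtain y where "[y = u] (mod a)" "[y = v] (mod b)"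
      using binary_chinese_remainder_int[OF assms(1)] by blast
    then have "z = (y mod (a * b) mod a, y mod (a * b) mod b)"
      using z by (simp add: cong_def mod_mod_cancel)
    moreover have "y mod (a * b) \<in> {0..<a * b}"
      using assms by simp
    ultimately show "z \<in> (\<lambda>x. (x mod a, x mod b)) ` {0..<a * b}" by blast
  qed (use assms in auto)
qed

lemma card_sqrts_of_1_mult:
  assumes "coprime a b" and "a > 0" and "b > 0"
  shows "card (sqrts_of_1 (a * b)) = card (sqrts_of_1 a) * card (sqrts_of_1 b)"
proof -
  let ?f = "\<lambda>x. (x mod a, x mod b)"
  have "[x * x = 1] (mod a * b) \<longleftrightarrow>
      [(x mod a) * (x mod a) = 1] (mod a) \<and> [(x mod b) * (x mod b) = 1] (mod b)" for x
  proof -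
    have "[x * x = 1] (mod a * b) \<longleftrightarrow> [x * x = 1] (mod a) \<and> [x * x = 1] (mod b)"
      using assms(1) by (meson coprime_cong_mult cong_dvd_modulus dvd_triv_left dvd_triv_right)
    then show ?thesis by (simp add: cong_def mod_mult_eq)
  qed
  then have "sqrts_of_1 (a * b) = {x \<in> {0..<a * b}. ?f x \<in> sqrts_of_1 a \<times> sqrts_of_1 b}"
    using assms by (auto simp: sqrts_of_1_def)
  moreover have "bij_betw ?f {x \<in> {0..<a * b}. ?f x \<in> sqrts_of_1 a \<times> sqrts_of_1 b}
      (sqrts_of_1 a \<times> sqrts_of_1 b)"
  proof (rule bij_betw_subset[OF bij_betw_chinese_remainder[OF assms]])
    have "sqrts_of_1 a \<times> sqrts_of_1 b \<subseteq> ?f ` {0..<a * b}"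
      using bij_betw_imp_surj_on[OF bij_betw_chinese_remainder[OF assms]]
      by (auto simp: sqrts_of_1_def)
    then show "?f ` {x \<in> {0..<a * b}. ?f x \<in> sqrts_of_1 a \<times> sqrts_of_1 b} =
        sqrts_of_1 a \<times> sqrts_of_1 b"
      by blast
  qed blast
  ultimately show ?thesis
    by (metis bij_betw_same_card card_cartesian_product)
qed

lemma sqrts_of_1_dvd_iff:
  "x \<in> sqrts_of_1 m \<longleftrightarrow> x \<in> {0..<m} \<and> m dvd (x - 1) * (x + 1)"
  by (simp add: sqrts_of_1_def cong_iff_dvd_diff algebra_simps)

lemma card_sqrts_of_1_odd_prime_power:
  fixes p :: nat
  assumes "prime p" and "p \<noteq> 2" and "k \<ge> 1"
  shows "card (sqrts_of_1 (int (p ^ k))) = 2"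
proof -
  define q where "q = int p ^ k"
  have p: "prime (int p)" using assms by simp
  have p3: "p \<ge> 3"
    using assms prime_ge_2_nat[OF assms(1)] by linarith
  have "q \<ge> int p"
    using assms self_le_power[of "int p" k] p3 by (simp add: q_def)
  then have q3: "q \<ge> 3" using p3 by linarith
  have nd: "\<not> (int p dvd x - 1 \<and> int p dvd x + 1)" for x
  proof
    assume "int p dvd x - 1 \<and> int p dvd x + 1"
    then have "int p dvd (x + 1) - (x - 1)" by (blast intro: dvd_diff)
    then have "int p \<le> 2" by (intro zdvd_imp_le) simp_all
    with p3 show False by simp
  qed
  have "x \<in> sqrts_of_1 q \<longleftrightarrow> x \<in> {1, q - 1}" for x
  proof
    assume "x \<in> sqrts_of_1 q"
    then have x: "0 \<le> x" "x < q" and "q dvd (x - 1) * (x + 1)"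
      by (auto simp: sqrts_of_1_dvd_iff)
    with prime_power_dvd_mult_cases[OF p _ nd] consider "q dvd x - 1" | "q dvd x + 1"
      unfolding q_def by blast
    then show "x \<in> {1, q - 1}"
    proof cases
      case 1
      then have "[x = 1] (mod q)" by (simp add: cong_iff_dvd_diff)
      then show ?thesis using x q3 by (simp add: cong_less_imp_eq_int)
    next
      case 2
      then have "q \<le> x + 1" using x by (intro zdvd_imp_le) simp_all
      then show ?thesis using x by simp
    qed
  next
    assume "x \<in> {1, q - 1}"
    then show "x \<in> sqrts_of_1 q" using q3 by (auto simp: sqrts_of_1_dvd_iff)
  qed
  then have "sqrts_of_1 q = {1, q - 1}" by blast
  then show ?thesis using q3 by (simp add: q_def)
qed

lemma card_sqrts_of_1_2: "card (sqrts_of_1 2) = 1"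
proof -
  have "x \<in> sqrts_of_1 2 \<longleftrightarrow> x = 1" for x
    by (cases "x = 0") (auto simp: sqrts_of_1_dvd_iff)
  then have "sqrts_of_1 2 = {1}" by blast
  then show ?thesis by simp
qed

lemma card_sqrts_of_1_4: "card (sqrts_of_1 4) = 2"
proof -
  have "x \<in> sqrts_of_1 4 \<longleftrightarrow> x \<in> {1, 3}" for x
  proof -
    have "x \<in> {0..<4} \<longleftrightarrow> x \<in> {0, 1, 2, 3}" by auto
    then show ?thesis by (auto simp: sqrts_of_1_dvd_iff)
  qed
  then have "sqrts_of_1 4 = {1, 3}" by blast
  then show ?thesis by simp
qed

text \<open>
  Here 2 divides both \<open>x - 1\<close> and \<open>x + 1\<close>.  Writing \<open>x = 2y + 1\<close> turns the product into
  \<open>4 y (y + 1)\<close> with coprime factors \<open>y\<close> and \<open>y + 1\<close>, so one of them is divisible by \<open>2 ^ (k - 2)\<close>.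
  Hence \<open>x\<close> is congruent to 1 or -1 modulo \<open>h = 2 ^ (k - 1)\<close>, which leaves four residues
  modulo \<open>2 h\<close>.
\<close>

lemma card_sqrts_of_1_two_power:
  assumes "k \<ge> 3"
  shows "card (sqrts_of_1 (2 ^ k)) = 4"
proof -
  define h :: int where "h = 2 ^ (k - 1)"
  have q: "2 ^ k = 2 * h"
    using assms by (simp add: h_def flip: power_Suc)
  have "(2::int) ^ 2 \<le> 2 ^ (k - 1)"
    using assms by (intro power_increasing) auto
  then have h4: "h \<ge> 4" by (simp add: h_def)
  have "even h" using assms by (simp add: h_def)
  have "x \<in> sqrts_of_1 (2 * h) \<longleftrightarrow> x \<in> {1, h - 1, h + 1, 2 * h - 1}" for x
  proof
    assume "x \<in> sqrts_of_1 (2 * h)"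
    then have x: "0 \<le> x" "x < 2 * h" and dvd: "2 * h dvd (x - 1) * (x + 1)"
      by (auto simp: sqrts_of_1_dvd_iff)
    have "even ((x - 1) * (x + 1))" using dvd by (metis dvd_mult_left)
    then have "odd x" by auto
    then obtain y where y: "x = 2 * y + 1" by (elim oddE)
    define h' :: int where "h' = 2 ^ (k - 2)"
    have h': "h = 2 * h'"
      using assms by (simp add: h_def h'_def numeral_2_eq_2 Suc_diff_Suc flip: power_Suc)
    have "4 * h' dvd 4 * (y * (y + 1))"
      using dvd by (simp add: h' y algebra_simps)
    then have "h' dvd y * (y + 1)" by simp
    moreover have "\<not> (2 dvd y \<and> 2 dvd y + 1)" by presburger
    ultimately have "h' dvd y \<or> h' dvd y + 1"
      unfolding h'_def by (intro prime_power_dvd_mult_cases) auto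
    then consider c where "y = h' * c" | c where "y + 1 = h' * c" by (blast elim: dvdE)
    then show "x \<in> {1, h - 1, h + 1, 2 * h - 1}"
    proof cases
      case 1
      then have xc: "x = h * c + 1" by (simp add: y h')
      have "0 \<le> c"
      proof (rule ccontr)
        assume "\<not> 0 \<le> c"
        then have "h * c \<le> h * (- 1)" using h4 by (intro mult_left_mono) auto
        then show False using x xc h4 by linarith
      qed
      moreover have "c < 2"
      proof (rule ccontr)
        assume "\<not> c < 2"
        then have "h * 2 \<le> h * c" using h4 by simp
        then show False using x xc by linarith
      qed
      ultimately have "c = 0 \<or> c = 1" by auto
      then show ?thesis using xc by auto
    next
      case 2
      then have "x + 1 = 2 * (h' * c)" by (simp add: y flip: 2)
      then have xc: "x = h * c - 1" by (simp add: h')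
      have "0 < c"
      proof (rule ccontr)
        assume "\<not> 0 < c"
        then have "h * c \<le> h * 0" using h4 by (intro mult_left_mono) auto
        then show False using x xc by linarith
      qed
      moreover have "c < 3"
      proof (rule ccontr)
        assume "\<not> c < 3"
        then have "h * 3 \<le> h * c" using h4 by simp
        then show False using x xc h4 by linarith
      qed
      ultimately have "c = 1 \<or> c = 2" by auto
      then show ?thesis using xc by auto
    qed
  next
    assume "x \<in> {1, h - 1, h + 1, 2 * h - 1}"
    moreover have "2 * h dvd (h - 1 - 1) * (h - 1 + 1)" "2 * h dvd (h + 1 - 1) * (h + 1 + 1)"
      using \<open>even h\<close> by (auto simp: mult_dvd_mono algebra_simps elim!: evenE)
    ultimately show "x \<in> sqrts_of_1 (2 * h)"
      using h4 by (auto simp: sqrts_of_1_dvd_iff)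
  qed
  then have "sqrts_of_1 (2 * h) = {1, h - 1, h + 1, 2 * h - 1}" by blast
  then show ?thesis using h4 by (simp add: q card_insert_if)
qed

lemma (in residues) self_inverse_units_eq: "{u \<in> Units R. u \<otimes> u = \<one>} = sqrts_of_1 m"
proof -
  have "coprime x m" if "[x * x = 1] (mod m)" for x
    using that coprime_iff_invertible_int by blast
  moreover have "x \<noteq> 0" if "[x * x = 1] (mod m)" for x
    using that m_gt_one by (auto simp: cong_def)
  ultimately show ?thesis
    using m_gt_one by (auto simp: sqrts_of_1_def res_units_eq res_mult_eq res_one_eq cong_def less_le)
qed

section \<open>The clean graph for three prime factors\<close>

lemma totient_prime_power_diff:
  assumes "prime p" and "k \<ge> 1"
  shows "totient (p ^ k) = p ^ k - p ^ (k - 1)"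
proof -
  have "totient (p ^ k) = p ^ (k - 1) * p - p ^ (k - 1)"
    using assms by (simp add: totient_prime_power right_diff_distrib')
  also have "p ^ (k - 1) * p = p ^ k"
    using assms(2) by (simp flip: power_Suc2)
  finally show ?thesis .
qed

theorem proposition3:
  fixes p1 p2 p3 n1 n2 n3 :: nat
  assumes "prime p1" and "prime p2" and "prime p3"
    and "p1 \<noteq> p2" and "p1 \<noteq> p3" and "p2 \<noteq> p3"
    and "n1 \<ge> 1" and "n2 \<ge> 1" and "n3 \<ge> 1"
  defines "ClN \<equiv> clean_graph2 (residue_ring (int (p1 ^ n1 * p2 ^ n2 * p3 ^ n3)))"
    and "m \<equiv> (p1 ^ n1 - p1 ^ (n1 - 1)) * (p2 ^ n2 - p2 ^ (n2 - 1)) * (p3 ^ n3 - p3 ^ (n3 - 1))"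
  shows
    "(p1 ^ n1 = 2 \<longrightarrow>
        digraph_iso (with_proj ClN)
          (with_proj (shuriken 4
             ((p2 ^ n2 - p2 ^ (n2 - 1)) * (p3 ^ n3 - p3 ^ (n3 - 1))) G1))) \<and>
     (p1 ^ n1 = 4 \<longrightarrow>
        digraph_iso (with_proj ClN)
          (with_proj (shuriken 8
             (2 * (p2 ^ n2 - p2 ^ (n2 - 1)) * (p3 ^ n3 - p3 ^ (n3 - 1))) G1))) \<and>
     (p1 = 2 \<and> n1 \<ge> 3 \<longrightarrow>
        digraph_iso (with_proj ClN) (with_proj (shuriken 16 m G1))) \<and>
     (p1 \<noteq> 2 \<and> p2 \<noteq> 2 \<and> p3 \<noteq> 2 \<longrightarrow>
        digraph_iso (with_proj ClN) (with_proj (shuriken 8 m G1)))"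
proof -
  define q1 q2 q3 where "q1 = p1 ^ n1" and "q2 = p2 ^ n2" and "q3 = p3 ^ n3"
  note q_defs = q1_def q2_def q3_def
  have cop: "coprime q1 q2" "coprime q1 q3" "coprime q2 q3"
    using assms(1-6) by (auto simp: q_defs intro: primes_coprime)
  have pos: "q1 > 0" "q2 > 0" "q3 > 0"
    using assms(1-3) by (auto simp: q_defs prime_gt_0_nat)
  have pp: "primepow (int q1)" "primepow (int q2)" "primepow (int q3)"
    using assms(1-3,7-9) by (simp_all add: q_defs primepow_prime_power)
  define s where "s = (\<lambda>q. card (sqrts_of_1 (int q)))"
  define R where "R = residue_ring (int q1 * int q2 * int q3)"
  have gt1: "int q1 * int q2 * int q3 > 1"
    using pp[THEN primepow_int_gt_1] by (simp add: less_1_mult)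
  interpret residues "int q1 * int q2 * int q3" R
    using gt1 by unfold_locales (simp_all add: R_def)
  have "card {u \<in> Units R. u \<otimes>\<^bsub>R\<^esub> u = \<one>\<^bsub>R\<^esub>} = s q1 * s q2 * s q3"
    using cop pos by (simp add: self_inverse_units_eq card_sqrts_of_1_mult s_def)
  moreover have "card (Units R) = m"
  proof -
    have "card (Units R) = totient (q1 * q2 * q3)"
      using totient_eq by (simp add: nat_mult_distrib)
    also have "\<dots> = totient q1 * totient q2 * totient q3"
      using cop by (simp add: totient_mult_coprime)
    finally show ?thesis
      using assms(1-3,7-9) by (simp add: q_defs m_def totient_prime_power_diff)
  qed
  moreover have "clean_graph2 R = ClN"
    by (simp add: R_def ClN_def q_defs)
  ultimately have iso: "digraph_iso (with_proj ClN)
      (with_proj (shuriken (s q1 * s q2 * s q3) m G1))"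
    using clean_graph2_residue_ring3_iso_shuriken[of "int q1" "int q2" "int q3"] pp cop
    by (simp add: R_def)
  have odd: "s (p ^ k) = 2" if "prime p" "p \<noteq> 2" "k \<ge> 1" for p k
    unfolding s_def using that by (rule card_sqrts_of_1_odd_prime_power)
  \<comment> \<open>Used with \<open>j = 0\<close> and \<open>j = 1\<close>, for \<open>p1 ^ n1 = 2\<close> and \<open>p1 ^ n1 = 4\<close>.\<close>
  have p1_2: "p1 = 2" if "p1 ^ n1 = 2 ^ Suc j" for j
  proof -
    have "p1 dvd 2 ^ Suc j"
      using that assms(7) by (metis dvd_power One_nat_def Suc_le_eq)
    then show ?thesis
      using assms(1) by (metis prime_dvd_power_nat primes_dvd_imp_eq two_is_prime_nat)
  qed
  have p1_pow: "p1 ^ n1 = p1 * p1 ^ (n1 - 1)"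
    using assms(7) by (simp flip: power_Suc)
  show ?thesis
  proof (intro conjI impI)
    assume q: "p1 ^ n1 = 2"
    then have p1: "p1 = 2" using p1_2[of 0] by simp
    then have p1': "p1 ^ (n1 - 1) = 1" using q p1_pow by simp
    then have m: "m = (p2 ^ n2 - p2 ^ (n2 - 1)) * (p3 ^ n3 - p3 ^ (n3 - 1))"
      unfolding m_def q p1' by simp
    have "s q1 = 1" "s q2 = 2" "s q3 = 2"
      using assms p1 q odd by (simp_all add: q_defs s_def card_sqrts_of_1_2)
    then show "digraph_iso (with_proj ClN) (with_proj (shuriken 4
        ((p2 ^ n2 - p2 ^ (n2 - 1)) * (p3 ^ n3 - p3 ^ (n3 - 1))) G1))"
      using iso by (simp add: m)
  next
    assume q: "p1 ^ n1 = 4"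
    then have p1: "p1 = 2" using p1_2[of 1] by simp
    then have p1': "p1 ^ (n1 - 1) = 2" using q p1_pow by simp
    then have m: "m = 2 * (p2 ^ n2 - p2 ^ (n2 - 1)) * (p3 ^ n3 - p3 ^ (n3 - 1))"
      unfolding m_def q p1' by simp
    have "s q1 = 2" "s q2 = 2" "s q3 = 2"
      using assms p1 q odd by (simp_all add: q_defs s_def card_sqrts_of_1_4)
    then show "digraph_iso (with_proj ClN) (with_proj (shuriken 8
        (2 * (p2 ^ n2 - p2 ^ (n2 - 1)) * (p3 ^ n3 - p3 ^ (n3 - 1))) G1))"
      using iso by (simp add: m)
  next
    assume p1: "p1 = 2 \<and> n1 \<ge> 3"
    then have "s q1 = 4" "s q2 = 2" "s q3 = 2"
      using assms odd by (simp_all add: q_defs s_def card_sqrts_of_1_two_power)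
    then show "digraph_iso (with_proj ClN) (with_proj (shuriken 16 m G1))"
      using iso by simp
  next
    assume "p1 \<noteq> 2 \<and> p2 \<noteq> 2 \<and> p3 \<noteq> 2"
    then have "s q1 = 2" "s q2 = 2" "s q3 = 2"
      using assms odd by (simp_all add: q_defs)
    then show "digraph_iso (with_proj ClN) (with_proj (shuriken 8 m G1))"
      using iso by simp
  qed
qed

end
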